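(* For $n\ge1$ let $d_{n,3}(q):=\sum_{w\in\mathcal F_{n,2}}q^{\deg_3(G(w))}$. Then for all $n\ge3$, $$d_{n,3}(q)=q^2\bigl(d_{n-1,3}(q)+d_{n-2,3}(q)\bigr),$$ with $d_{1,3}(q)=q^2+1$ and $d_{2,3}(q)=3q^2$. Moreover, for all $n\ge1$, $$d_{n,3}(q)=\sum_{i=0}^{n}\left((1+q^2)q^{2(n-1-i)}\binom{n-i-1}{i}+(2q^2-q^4)q^{2(n-2-i)}\binom{n-i-2}{i}\right).$$
   Context: $\mathcal F_{n,2}$ is the set of binary words $w=w_1\cdots w_n$ with no two consecutive $1$'s. $P(w)$ is the bargraph polyomino formed by the unit squares $[i-1,i]\times[j-1,j]$, $1\le i\le n$, $1\le j\le w_i+1$. $G(w)$ is the graph whose vertices are the corners of the cells of $P(w)$ and whose edges are the cell sides. $\deg_3(G)$ is the number of vertices of degree $3$ in $G$. Binomial coefficients with integer arguments are $0$ whenever the lower index exceeds the upper index or the lower index is negative (e.g. $\binom{-1}{0}=0$). *)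

theory Defs
  imports "HOL-Computational_Algebra.Polynomial"
begin

text \<open>The letter \<open>w\<^sub>i\<close> (with \<open>1 \<le> i \<le> n\<close>) of a word is \<open>w ! (i - 1)\<close>.\<close>

definition fib_words :: "nat \<Rightarrow> nat list set" where
  "fib_words n = {w. length w = n \<and> set w \<subseteq> {0, 1} \<and>
     (\<forall>i. i + 1 < n \<longrightarrow> \<not> (w ! i = 1 \<and> w ! (i + 1) = 1))}"

lemma finite_fib_words: "finite (fib_words n)"
proof (rule finite_subset)
  show "fib_words n \<subseteq> {w. set w \<subseteq> {0, 1} \<and> length w = n}"
    by (auto simp: fib_words_def)
  show "finite {w :: nat list. set w \<subseteq> {0, 1} \<and> length w = n}"
    by (rule finite_lists_length_eq) simp
qed

text \<open>The pair \<open>(i, j)\<close> with \<open>i, j \<ge> 1\<close> stands for the unit square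
  \<open>[i - 1, i] \<times> [j - 1, j]\<close>.\<close>

definition bargraph_cells :: "nat list \<Rightarrow> (nat \<times> nat) set" where
  "bargraph_cells w = {(i, j). 1 \<le> i \<and> i \<le> length w \<and> 1 \<le> j \<and> j \<le> w ! (i - 1) + 1}"

fun cell_corners :: "nat \<times> nat \<Rightarrow> (nat \<times> nat) set" where
  "cell_corners (i, j) = {(i - 1, j - 1), (i, j - 1), (i - 1, j), (i, j)}"

fun cell_sides :: "nat \<times> nat \<Rightarrow> (nat \<times> nat) set set" where
  "cell_sides (i, j) =
     {{(i - 1, j - 1), (i, j - 1)}, {(i - 1, j), (i, j)},
      {(i - 1, j - 1), (i - 1, j)}, {(i, j - 1), (i, j)}}"

text \<open>A simple graph is a pair of a vertex set and a set of two-element sets of vertices.\<close>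

type_synonym 'a sgraph = "'a set \<times> 'a set set"

definition bargraph_graph :: "nat list \<Rightarrow> (nat \<times> nat) sgraph" where
  "bargraph_graph w =
     (\<Union> (cell_corners ` bargraph_cells w), \<Union> (cell_sides ` bargraph_cells w))"

definition vertex_degree :: "'a sgraph \<Rightarrow> 'a \<Rightarrow> nat" where
  "vertex_degree G v = card {e \<in> snd G. v \<in> e}"

definition deg3 :: "'a sgraph \<Rightarrow> nat" where
  "deg3 G = card {v \<in> fst G. vertex_degree G v = 3}"

abbreviation qv :: "int poly" where
  "qv \<equiv> [:0, 1:]"

definition d3 :: "nat \<Rightarrow> int poly" where
  "d3 n = (\<Sum>w\<in>fib_words n. qv ^ deg3 (bargraph_graph w))"

definition int_binom :: "int \<Rightarrow> int \<Rightarrow> nat" where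
  "int_binom m k = (if 0 \<le> k \<and> k \<le> m then nat m choose nat k else 0)"

text \<open>A power of \<open>qv\<close> with integer exponent. The junk value \<open>1\<close> for a negative exponent is
  harmless in the closed formula for \<open>d3\<close>: there the factors \<open>qv_pow (2 * m)\<close> and
  \<open>int_binom m i\<close> share the same \<open>m\<close>, and the latter is \<open>0\<close> when \<open>m < 0\<close>.\<close>

definition qv_pow :: "int \<Rightarrow> int poly" where
  "qv_pow e = qv ^ nat e"

end

theory Submission
  imports Defs
begin

text \<open>The degree of a corner at abscissa \<open>x\<close> depends only on the heights of the two columns meeting
  there, so the number of degree-3 vertices is a sum of local contributions of adjacent heights
  (with height \<open>0\<close> outside the word). The words of length \<open>n + 2\<close> split into \<open>0u\<close> and \<open>10v\<close>.
  Counting the continuations of a prefix that ends in \<open>0\<close>, each such block contributes a factor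
  \<open>q\<^sup>2\<close>, which gives the recurrence; the closed form satisfies the same recurrence by Pascal's
  rule.\<close>

section \<open>Vertex degrees in bargraph graphs\<close>

text \<open>The value 0 outside the word makes both ends of the polyomino ordinary steps between
  adjacent columns, with no separate boundary case.\<close>

definition bar_height :: "nat list \<Rightarrow> nat \<Rightarrow> nat" where
  "bar_height w x = (if 1 \<le> x \<and> x \<le> length w then w ! (x - 1) + 1 else 0)"

lemma mem_bargraph_cells_iff: "(i, j) \<in> bargraph_cells w \<longleftrightarrow> 1 \<le> j \<and> j \<le> bar_height w i"
  by (auto simp: bargraph_cells_def bar_height_def)

lemma bar_height_0 [simp]: "bar_height w 0 = 0"
  by (simp add: bar_height_def)

text \<open>Such a segment is the top of cell \<open>y\<close> or the bottom of cell
  \<open>Suc y\<close> of its column. Columns are filled from below, so the cell at height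
  \<open>max y 1\<close> suffices as a witness; the maximum excludes the empty column when
  \<open>y = 0\<close>.\<close>

lemma horizontal_edge_iff:
  "{(x, y), (Suc x, y)} \<in> snd (bargraph_graph w) \<longleftrightarrow> max y 1 \<le> bar_height w (Suc x)"
proof
  assume "{(x, y), (Suc x, y)} \<in> snd (bargraph_graph w)"
  then obtain i j where c: "(i, j) \<in> bargraph_cells w"
    and e: "{(x, y), (Suc x, y)} \<in> cell_sides (i, j)"
    by (auto simp: bargraph_graph_def simp del: cell_sides.simps)
  have "i \<ge> 1" using c by (simp add: bargraph_cells_def)
  then have "i = Suc x \<and> (y = j \<or> y = j - 1)"
    using e by (auto simp: doubleton_eq_iff)
  then show "max y 1 \<le> bar_height w (Suc x)"
    using c by (auto simp: mem_bargraph_cells_iff)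
next
  assume h: "max y 1 \<le> bar_height w (Suc x)"
  have "(Suc x, max y 1) \<in> bargraph_cells w"
    using h by (simp add: mem_bargraph_cells_iff)
  moreover have "{(x, y), (Suc x, y)} \<in> cell_sides (Suc x, max y 1)"
    by (cases "y = 0") auto
  ultimately show "{(x, y), (Suc x, y)} \<in> snd (bargraph_graph w)"
    unfolding bargraph_graph_def snd_conv by blast
qed

text \<open>The segment is a side of the cell to its left or of the cell to its right, so the higher
  of the two columns decides.\<close>

lemma vertical_edge_iff:
  "{(x, y), (x, Suc y)} \<in> snd (bargraph_graph w)
     \<longleftrightarrow> y < max (bar_height w x) (bar_height w (Suc x))"
proof
  assume "{(x, y), (x, Suc y)} \<in> snd (bargraph_graph w)"
  then obtain i j where c: "(i, j) \<in> bargraph_cells w"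
    and e: "{(x, y), (x, Suc y)} \<in> cell_sides (i, j)"
    by (auto simp: bargraph_graph_def simp del: cell_sides.simps)
  have "i \<ge> 1" "j \<ge> 1" using c by (simp_all add: bargraph_cells_def)
  then have "j = Suc y \<and> (i = x \<or> i = Suc x)"
    using e by (auto simp: doubleton_eq_iff)
  then show "y < max (bar_height w x) (bar_height w (Suc x))"
    using c by (auto simp: mem_bargraph_cells_iff)
next
  assume "y < max (bar_height w x) (bar_height w (Suc x))"
  then consider "y < bar_height w x" | "y < bar_height w (Suc x)" by linarith
  then obtain i where i: "(i, Suc y) \<in> bargraph_cells w" "i = x \<or> i = Suc x"
    by cases (simp_all add: mem_bargraph_cells_iff Suc_le_eq)
  from i(2) have "{(x, y), (x, Suc y)} \<in> cell_sides (i, Suc y)"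
    by (elim disjE) simp_all
  then show "{(x, y), (x, Suc y)} \<in> snd (bargraph_graph w)"
    unfolding bargraph_graph_def snd_conv using i by blast
qed

lemma bargraph_edge_cases:
  assumes "e \<in> snd (bargraph_graph w)"
  obtains x y where "e = {(x, y), (Suc x, y)}" | x y where "e = {(x, y), (x, Suc y)}"
proof -
  obtain i j where c: "(i, j) \<in> bargraph_cells w" and e: "e \<in> cell_sides (i, j)"
    using assms by (auto simp: bargraph_graph_def simp del: cell_sides.simps)
  obtain x y where "i = Suc x" "j = Suc y"
    using c by (cases i; cases j) (auto simp: bargraph_cells_def)
  then show thesis using e that by auto
qed

text \<open>The four indicators stand for the left, right, upper and lower segment at the
  point.\<close>

lemma vertex_degree_bargraph:
  fixes w x y
  defines "a \<equiv> bar_height w x" and "b \<equiv> bar_height w (Suc x)"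
  shows "vertex_degree (bargraph_graph w) (x, y)
    = of_bool (max y 1 \<le> a) + of_bool (max y 1 \<le> b)
      + of_bool (y < max a b) + of_bool (1 \<le> y \<and> y \<le> max a b)"
proof -
  let ?E = "snd (bargraph_graph w)"
  define L where "L = (if max y 1 \<le> a then {{(x - 1, y), (x, y)}} else {})"
  define R where "R = (if max y 1 \<le> b then {{(x, y), (Suc x, y)}} else {})"
  define U where "U = (if y < max a b then {{(x, y), (x, Suc y)}} else {})"
  define D where "D = (if 1 \<le> y \<and> y \<le> max a b then {{(x, y - 1), (x, y)}} else {})"
  \<comment> \<open>At \<open>x = 0\<close> the truncated \<open>x - 1\<close> would make the left
    segment degenerate; column 0 has height 0, so this case cannot occur.\<close>
  have xpos: "x \<noteq> 0" if "max y 1 \<le> a"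
    using that by (cases "x = 0") (simp_all add: a_def)
  have sub: "L \<union> R \<union> U \<union> D \<subseteq> {e \<in> ?E. (x, y) \<in> e}"
  proof -
    have "L \<subseteq> ?E"
      using xpos horizontal_edge_iff[of "x - 1" y w] by (auto simp: L_def a_def)
    moreover have "R \<subseteq> ?E"
      using horizontal_edge_iff[of x y w] by (auto simp: R_def b_def)
    moreover have "U \<subseteq> ?E"
      using vertical_edge_iff[of x y w] by (auto simp: U_def a_def b_def)
    moreover have "D \<subseteq> ?E"
      using vertical_edge_iff[of x "y - 1" w] by (auto simp: D_def a_def b_def)
    ultimately show ?thesis
      by (auto simp: L_def R_def U_def D_def split: if_splits)
  qed
  have "{e \<in> ?E. (x, y) \<in> e} \<subseteq> L \<union> R \<union> U \<union> D"
  proof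
    fix e assume "e \<in> {e \<in> ?E. (x, y) \<in> e}"
    then have e: "e \<in> ?E" "(x, y) \<in> e" by auto
    from e(1) show "e \<in> L \<union> R \<union> U \<union> D"
    proof (cases rule: bargraph_edge_cases)
      case (1 x' y')
      then have "max y 1 \<le> bar_height w (Suc x')" "y' = y" "x = x' \<or> x = Suc x'"
        using e horizontal_edge_iff[of x' y' w] by auto
      then show ?thesis using 1 by (auto simp: L_def R_def a_def b_def)
    next
      case (2 x' y')
      then have "y' < max a b" "x' = x" "y = y' \<or> y = Suc y'"
        using e vertical_edge_iff[of x' y' w] by (auto simp: a_def b_def)
      then show ?thesis using 2 by (auto simp: U_def D_def)
    qed
  qed
  with sub have eq: "{e \<in> ?E. (x, y) \<in> e} = L \<union> R \<union> U \<union> D" by blast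
  have disj: "L \<inter> R = {}" "(L \<union> R) \<inter> U = {}" "(L \<union> R \<union> U) \<inter> D = {}"
    using xpos by (auto simp: L_def R_def U_def D_def doubleton_eq_iff split: if_splits)
  have fin: "finite L" "finite R" "finite U" "finite D"
    by (simp_all add: L_def R_def U_def D_def)
  have "card (L \<union> R \<union> U \<union> D) = card L + card R + card U + card D"
    using disj fin by (simp add: card_Un_disjoint)
  then show ?thesis
    unfolding vertex_degree_def eq by (simp add: L_def R_def U_def D_def)
qed

section \<open>Counting degree-3 vertices along vertical lines\<close>

lemma vertex_in_bargraph_if_le:
  assumes "y \<le> max (bar_height w x) (bar_height w (Suc x))"
    and "0 < max (bar_height w x) (bar_height w (Suc x))"
  shows "(x, y) \<in> fst (bargraph_graph w)"
proof -
  from assms consider "max y 1 \<le> bar_height w x" | "max y 1 \<le> bar_height w (Suc x)"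
    by linarith
  then obtain i where i: "(i, max y 1) \<in> bargraph_cells w" "i = x \<or> i = Suc x"
    by cases (auto simp: mem_bargraph_cells_iff)
  from i(2) have "(x, y) \<in> cell_corners (i, max y 1)"
    by (cases "y = 0") auto
  then show ?thesis
    unfolding bargraph_graph_def fst_conv using i by blast
qed

definition step_deg3 :: "nat \<Rightarrow> nat \<Rightarrow> nat" where
  "step_deg3 a b = (if a = b then (if a = 0 then 0 else 2)
     else of_bool (0 < min a b) + (max a b - min a b - 1))"

text \<open>Between equal positive heights only the bottom and the top point lack exactly one
  segment. Between different heights the points strictly between the two tops lack one horizontal
  segment, and the bottom point has degree 3 iff both columns are nonempty.\<close>

lemma card_deg3_in_column:
  "card {y. vertex_degree (bargraph_graph w) (x, y) = 3}
     = step_deg3 (bar_height w x) (bar_height w (Suc x))"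
proof -
  define a b where "a = bar_height w x" and "b = bar_height w (Suc x)"
  have "{y. vertex_degree (bargraph_graph w) (x, y) = 3}
      = (if a = b then (if a = 0 then {} else {0, a})
         else (if 0 < min a b then {0} else {}) \<union> {min a b <..< max a b})"
    unfolding vertex_degree_bargraph a_def[symmetric] b_def[symmetric]
    by (auto simp: of_bool_def min_def max_def split: if_splits)
  then show ?thesis
    by (auto simp: step_deg3_def a_def[symmetric] b_def[symmetric])
qed

lemma deg3_bargraph_eq_sum:
  "deg3 (bargraph_graph w)
     = (\<Sum>x\<le>length w. step_deg3 (bar_height w x) (bar_height w (Suc x)))"
proof -
  let ?G = "bargraph_graph w"
  let ?S = "Sigma {..length w} (\<lambda>x. {y. vertex_degree ?G (x, y) = 3})"
  \<comment> \<open>The column count ranges over all points of the line, so points of degree 3 must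
    be shown to be vertices of the graph with abscissa in range.\<close>
  have deg3: "x \<le> length w \<and> (x, y) \<in> fst ?G \<and> y \<le> max (bar_height w x) (bar_height w (Suc x))"
    if d: "vertex_degree ?G (x, y) = 3" for x y
  proof -
    have m: "y \<le> max (bar_height w x) (bar_height w (Suc x))"
      "0 < max (bar_height w x) (bar_height w (Suc x))"
      using d unfolding vertex_degree_bargraph by (auto simp: of_bool_def split: if_splits)
    then show ?thesis using vertex_in_bargraph_if_le[OF m]
      by (auto simp: bar_height_def split: if_splits)
  qed
  have "{v \<in> fst ?G. vertex_degree ?G v = 3} = ?S"
    using deg3 by auto
  moreover have "finite {y. vertex_degree ?G (x, y) = 3}" for x
    by (rule finite_subset[of _ "{..max (bar_height w x) (bar_height w (Suc x))}"])
      (use deg3 in auto)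
  ultimately show ?thesis
    by (simp add: deg3_def card_SigmaI card_deg3_in_column)
qed

text \<open>The first argument is the height of the column preceding the word.\<close>

fun deg3_after :: "nat \<Rightarrow> nat list \<Rightarrow> nat" where
  "deg3_after a [] = step_deg3 a 0"
| "deg3_after a (c # w) = step_deg3 a (Suc c) + deg3_after (Suc c) w"

text \<open>The list \<open>map Suc w @ [0]\<close> holds the column heights closed by the empty
  column; prefixing \<open>a\<close> shifts it by one, so equal indices give adjacent
  heights.\<close>

lemma deg3_after_eq_sum:
  "deg3_after a w = (\<Sum>x\<le>length w. step_deg3 ((a # map Suc w @ [0]) ! x) ((map Suc w @ [0]) ! x))"
  by (induction w arbitrary: a) (simp_all add: sum.atMost_Suc_shift del: sum.atMost_Suc)

lemma deg3_bargraph_eq_deg3_after: "deg3 (bargraph_graph w) = deg3_after 0 w"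
  unfolding deg3_bargraph_eq_sum deg3_after_eq_sum
proof (rule sum.cong)
  fix x assume "x \<in> {..length w}"
  then show "step_deg3 (bar_height w x) (bar_height w (Suc x))
      = step_deg3 ((0 # map Suc w @ [0]) ! x) ((map Suc w @ [0]) ! x)"
    by (cases x) (auto simp: bar_height_def nth_append Suc_le_eq)
qed simp

section \<open>The recurrence\<close>

lemma fib_words_0: "fib_words 0 = {[]}"
  by (auto simp: fib_words_def)

lemma fib_words_1: "fib_words (Suc 0) = {[0], [1]}"
  by (auto simp: fib_words_def length_Suc_conv)

lemma Cons_in_fib_words_iff:
  "c # w \<in> fib_words (Suc n)
     \<longleftrightarrow> c \<in> {0, 1} \<and> \<not> (c = 1 \<and> w \<noteq> [] \<and> hd w = 1) \<and> w \<in> fib_words n"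
proof -
  \<comment> \<open>Separates the condition on the first two letters from those inside
    \<open>w\<close>.\<close>
  have split: "(\<forall>i. P i) \<longleftrightarrow> P 0 \<and> (\<forall>i. P (Suc i))" for P :: "nat \<Rightarrow> bool"
    by (metis not0_implies_Suc)
  show ?thesis
    unfolding fib_words_def mem_Collect_eq
    by (subst split) (cases w; auto)
qed

lemma zero_Cons_in_fib_words_iff: "0 # w \<in> fib_words (Suc n) \<longleftrightarrow> w \<in> fib_words n"
  by (simp add: Cons_in_fib_words_iff)

lemma one_zero_Cons_in_fib_words_iff:
  "1 # 0 # w \<in> fib_words (Suc (Suc n)) \<longleftrightarrow> w \<in> fib_words n"
  by (simp add: Cons_in_fib_words_iff)

lemma fib_words_Suc_Suc:
  "fib_words (Suc (Suc n))
     = (\<lambda>w. 0 # w) ` fib_words (Suc n) \<union> (\<lambda>w. 1 # 0 # w) ` fib_words n"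
proof
  show "fib_words (Suc (Suc n))
     \<subseteq> (\<lambda>w. 0 # w) ` fib_words (Suc n) \<union> (\<lambda>w. 1 # 0 # w) ` fib_words n"
  proof
    fix w assume w: "w \<in> fib_words (Suc (Suc n))"
    then obtain a b u where wu: "w = a # b # u"
      by (auto simp: fib_words_def length_Suc_conv)
    have "a \<in> {0, 1}" "b \<in> {0, 1}" using w by (auto simp: fib_words_def wu)
    moreover have "\<not> (a = 1 \<and> b = 1)"
      using w by (auto simp: fib_words_def wu dest: spec[of _ 0])
    ultimately consider "a = 0" | "a = 1" "b = 0" by auto
    then show "w \<in> (\<lambda>w. 0 # w) ` fib_words (Suc n) \<union> (\<lambda>w. 1 # 0 # w) ` fib_words n"
      using w zero_Cons_in_fib_words_iff one_zero_Cons_in_fib_words_iff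
      by cases (auto simp: wu)
  qed
next
  show "(\<lambda>w. 0 # w) ` fib_words (Suc n) \<union> (\<lambda>w. 1 # 0 # w) ` fib_words n
     \<subseteq> fib_words (Suc (Suc n))"
    using zero_Cons_in_fib_words_iff one_zero_Cons_in_fib_words_iff by auto
qed

lemma sum_fib_words_Suc_Suc:
  "sum f (fib_words (Suc (Suc n)))
     = (\<Sum>w\<in>fib_words (Suc n). f (0 # w)) + (\<Sum>w\<in>fib_words n. f (1 # 0 # w))"
proof -
  have "sum f (fib_words (Suc (Suc n)))
      = sum f ((\<lambda>w. 0 # w) ` fib_words (Suc n)) + sum f ((\<lambda>w. 1 # 0 # w) ` fib_words n)"
    unfolding fib_words_Suc_Suc
    by (rule sum.union_disjoint) (auto simp: finite_fib_words)
  then show ?thesis by (simp add: sum.reindex inj_on_def)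
qed

text \<open>A letter 0 has a column of height 1. Both blocks 0 and 10 end in this state, so a single
  auxiliary sequence closes the recursion.\<close>

definition d3_after_zero :: "nat \<Rightarrow> int poly" where
  "d3_after_zero n = (\<Sum>w\<in>fib_words n. qv ^ deg3_after 1 w)"

lemma d3_eq: "d3 n = (\<Sum>w\<in>fib_words n. qv ^ deg3_after 0 w)"
  by (simp add: d3_def deg3_bargraph_eq_deg3_after)

text \<open>From the empty column, the step to height 1 contributes nothing, while the steps to
  height 2 and down to 1 contribute one vertex each.\<close>

lemma d3_Suc_Suc: "d3 (Suc (Suc n)) = d3_after_zero (Suc n) + qv ^ 2 * d3_after_zero n"
  unfolding d3_eq d3_after_zero_def sum_fib_words_Suc_Suc
  by (simp add: step_deg3_def sum_distrib_left power2_eq_square)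

text \<open>From height 1, a further height 1 contributes two vertices, and so do the steps up to 2
  and back to 1.\<close>

lemma d3_after_zero_Suc_Suc:
  "d3_after_zero (Suc (Suc n)) = qv ^ 2 * (d3_after_zero (Suc n) + d3_after_zero n)"
  unfolding d3_after_zero_def sum_fib_words_Suc_Suc
  by (simp add: step_deg3_def sum_distrib_left power2_eq_square distrib_left)

lemma d3_after_zero_0: "d3_after_zero 0 = 1"
  by (simp add: d3_after_zero_def fib_words_0 step_deg3_def)

lemma d3_after_zero_1: "d3_after_zero (Suc 0) = 2 * qv ^ 2"
proof -
  have "d3_after_zero (Suc 0) = qv ^ 2 + qv ^ 2"
    by (simp add: d3_after_zero_def fib_words_1 step_deg3_def numeral_2_eq_2)
  then show ?thesis by (simp only: mult_2)
qed

lemma d3_1: "d3 (Suc 0) = qv ^ 2 + 1"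
  by (simp add: d3_eq fib_words_1 step_deg3_def numeral_2_eq_2)

lemma d3_2: "d3 (Suc (Suc 0)) = 3 * qv ^ 2"
  unfolding d3_Suc_Suc d3_after_zero_0 d3_after_zero_1 by algebra

lemma d3_recurrence:
  "d3 (Suc (Suc (Suc n))) = qv ^ 2 * (d3 (Suc (Suc n)) + d3 (Suc n))"
proof (cases n)
  \<comment> \<open>\<open>d3 1\<close> is not covered by \<open>d3_Suc_Suc\<close>, so this
    instance is checked from explicit values.\<close>
  case 0
  show ?thesis
    unfolding 0 d3_Suc_Suc d3_1 d3_after_zero_Suc_Suc d3_after_zero_0 d3_after_zero_1 by algebra
next
  case (Suc m)
  show ?thesis
    unfolding Suc d3_Suc_Suc d3_after_zero_Suc_Suc by algebra
qed

section \<open>The closed form\<close>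

text \<open>Fibonacci polynomial: it enumerates tilings of a strip of length \<open>m\<close> by
  squares and \<open>i\<close> dominoes, with weight \<open>t\<close> per tile. Terms with
  \<open>2 * i > m\<close> vanish.\<close>

definition fib_poly :: "'a::comm_semiring_1 \<Rightarrow> nat \<Rightarrow> 'a" where
  "fib_poly t m = (\<Sum>i\<le>m. t ^ (m - i) * of_nat (m - i choose i))"

lemma fib_poly_Suc_Suc: "fib_poly t (Suc (Suc m)) = t * (fib_poly t (Suc m) + fib_poly t m)"
proof -
  let ?T = "\<Sum>j\<le>m. t ^ Suc (m - j) * of_nat (m - j choose Suc j)"
  have "fib_poly t (Suc (Suc m))
      = t ^ Suc (Suc m) + (\<Sum>j\<le>Suc m. t ^ (Suc m - j) * of_nat (Suc m - j choose Suc j))"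
    unfolding fib_poly_def by (subst sum.atMost_Suc_shift) simp
  also have "(\<Sum>j\<le>Suc m. t ^ (Suc m - j) * of_nat (Suc m - j choose Suc j))
      = (\<Sum>j\<le>m. t ^ (Suc m - j) * of_nat (Suc m - j choose Suc j))"
    by simp
  \<comment> \<open>Pascal's rule for \<open>Suc (m - j) choose Suc j\<close>.\<close>
  also have "\<dots> = (\<Sum>j\<le>m. t * (t ^ (m - j) * of_nat (m - j choose j))
        + t ^ Suc (m - j) * of_nat (m - j choose Suc j))"
    by (rule sum.cong) (auto simp: Suc_diff_le algebra_simps)
  also have "\<dots> = t * fib_poly t m + ?T"
    by (simp add: sum.distrib fib_poly_def sum_distrib_left)
  finally have "fib_poly t (Suc (Suc m)) = t * fib_poly t m + (t ^ Suc (Suc m) + ?T)"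
    by (simp add: algebra_simps)
  \<comment> \<open>The separated power is the missing term \<open>i = 0\<close> of
    \<open>t * fib_poly t (Suc m)\<close>.\<close>
  also have "t ^ Suc (Suc m) + ?T = t * fib_poly t (Suc m)"
    unfolding fib_poly_def
    by (subst sum.atMost_Suc_shift) (simp add: sum_distrib_left algebra_simps)
  finally show ?thesis by (simp add: algebra_simps)
qed

lemma sum_qv_pow_int_binom:
  assumes "m \<le> n"
  shows "(\<Sum>i=0..n. qv_pow (2 * (int m - int i)) * of_nat (int_binom (int m - int i) (int i)))
    = fib_poly (qv ^ 2) m"
proof -
  have "(\<Sum>i=0..n. qv_pow (2 * (int m - int i)) * of_nat (int_binom (int m - int i) (int i)))
      = (\<Sum>i\<le>m. qv_pow (2 * (int m - int i)) * of_nat (int_binom (int m - int i) (int i)))"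
    \<comment> \<open>For \<open>i > m\<close> the upper index is negative and
      \<open>int_binom\<close> is 0.\<close>
    using assms by (intro sum.mono_neutral_right) (auto simp: int_binom_def)
  also have "\<dots> = fib_poly (qv ^ 2) m"
    unfolding fib_poly_def
  proof (rule sum.cong)
    fix i assume "i \<in> {..m}"
    then have "int m - int i = int (m - i)" by (simp add: of_nat_diff)
    moreover have "qv_pow (2 * int k) = (qv ^ 2) ^ k" for k
      by (simp add: qv_pow_def nat_mult_distrib power_mult)
    moreover have "int_binom (int k) (int i) = (k choose i)" for k
      by (simp add: int_binom_def)
    ultimately show "qv_pow (2 * (int m - int i)) * of_nat (int_binom (int m - int i) (int i))
        = (qv ^ 2) ^ (m - i) * of_nat (m - i choose i)"
      by (simp only:)
  qed simp
  finally show ?thesis .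
qed

text \<open>Both sides obey the same recurrence, so two initial values suffice. The coefficients are
  \<open>d3 1\<close> and \<open>d3 2 - qv ^ 2 * d3 1\<close>, as \<open>fib_poly t\<close> starts
  with 1 and \<open>t\<close>.\<close>

lemma d3_Suc_Suc_eq_fib_poly:
  "d3 (Suc (Suc m))
     = (1 + qv ^ 2) * fib_poly (qv ^ 2) (Suc m) + (2 * qv ^ 2 - qv ^ 4) * fib_poly (qv ^ 2) m"
proof (induction m rule: induct_nat_012)
  case 0
  show ?case unfolding d3_2 by (simp add: fib_poly_def) algebra
next
  case 1
  show ?case unfolding d3_recurrence[of 0] d3_2 d3_1 fib_poly_Suc_Suc
    by (simp add: fib_poly_def) algebra
next
  case (ge2 m)
  show ?case unfolding d3_recurrence[of "Suc m"] ge2 fib_poly_Suc_Suc by algebra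
qed

lemma d3_closed_form:
  assumes "n \<ge> 1"
  shows "d3 n =
        (\<Sum>i=0..n.
            (1 + qv ^ 2) * qv_pow (2 * (int n - 1 - int i))
              * of_nat (int_binom (int n - int i - 1) (int i))
          + (2 * qv ^ 2 - qv ^ 4) * qv_pow (2 * (int n - 2 - int i))
              * of_nat (int_binom (int n - int i - 2) (int i)))" (is "_ = ?R")
proof -
  let ?S = "\<lambda>k. \<Sum>i=0..n. qv_pow (2 * (k - int i)) * of_nat (int_binom (k - int i) (int i))"
  have comm: "int n - int i - c = int n - c - int i" for i c by simp
  have R: "?R = (1 + qv ^ 2) * ?S (int n - 1) + (2 * qv ^ 2 - qv ^ 4) * ?S (int n - 2)"
    unfolding comm by (simp only: sum.distrib sum_distrib_left mult.assoc)
  obtain m where n: "n = Suc m" using assms by (cases n) auto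
  have S1: "?S (int n - 1) = fib_poly (qv ^ 2) m"
    using sum_qv_pow_int_binom[of m n] by (simp add: n)
  show ?thesis
  proof (cases m)
    case 0
    \<comment> \<open>For \<open>n = 1\<close> all upper indices \<open>-1 - i\<close> are
      negative.\<close>
    have "?S (int n - 2) = 0"
      by (rule sum.neutral) (auto simp: n 0 int_binom_def)
    then show ?thesis
      unfolding R S1 by (simp add: n 0 d3_1 fib_poly_def)
  next
    case (Suc k)
    have "?S (int n - 2) = fib_poly (qv ^ 2) k"
      using sum_qv_pow_int_binom[of k n] by (simp add: n Suc)
    then show ?thesis
      unfolding R S1 by (simp only: n Suc d3_Suc_Suc_eq_fib_poly)
  qed
qed

theorem theorem3p6:
  shows "(\<forall>n\<ge>3. d3 n = qv ^ 2 * (d3 (n - 1) + d3 (n - 2)))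
    \<and> d3 1 = qv ^ 2 + 1
    \<and> d3 2 = 3 * qv ^ 2
    \<and> (\<forall>n\<ge>1. d3 n =
        (\<Sum>i=0..n.
            (1 + qv ^ 2) * qv_pow (2 * (int n - 1 - int i))
              * of_nat (int_binom (int n - int i - 1) (int i))
          + (2 * qv ^ 2 - qv ^ 4) * qv_pow (2 * (int n - 2 - int i))
              * of_nat (int_binom (int n - int i - 2) (int i))))"
proof (intro conjI allI impI)
  fix n :: nat assume "n \<ge> 3"
  then have "n = Suc (Suc (Suc (n - 3)))" by simp
  then obtain m where "n = Suc (Suc (Suc m))" by blast
  then show "d3 n = qv ^ 2 * (d3 (n - 1) + d3 (n - 2))"
    using d3_recurrence by simp
next
  show "d3 1 = qv ^ 2 + 1" "d3 2 = 3 * qv ^ 2"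
    using d3_1 d3_2 by (simp_all only: One_nat_def numeral_2_eq_2)
qed (rule d3_closed_form)

end
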